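(* Let $\mathbf{R}=[\mathbf{R}_{x,y}\ \ \mathbf{R}_z]\in\mathbb{R}^{3\times3}$ be a rotation matrix, where $\mathbf{R}_{x,y}\in\mathbb{R}^{3\times 2}$ consists of the first two columns and $\mathbf{R}_z\in\mathbb{R}^3$ is the third column, and let $\mathbf{t}\in\mathbb{R}^3$. Then the torque at the center of mass $$\boldsymbol{\kappa}=\mathbf{R}_z\hat{\tau}+(\mathbf{R}_{x,y}\hat{\mathbf{p}}+\mathbf{t}-\mathbf{r})\times(\mathbf{R}\hat{\mathbf{f}}),$$ viewed as a function of $(\hat{\mathbf{f}},\hat{\tau},\hat{\mathbf{p}},\mathbf{r})\in\mathbb{R}^3\times\mathbb{R}\times\mathbb{R}^2\times\mathbb{R}^3$, is an element of $\mathcal{Q}_\pm$. Consequently, for finitely many contacts $e=1,\dots,E$ with rotations $\mathbf{R}_e$, translations $\mathbf{t}_e$ and activations $\alpha_e\in\{0,1\}$, the angular momentum rate $\dot{\mathbf{k}}=\sum_{e=1}^E\alpha_e\boldsymbol{\kappa}_e$, where $\boldsymbol{\kappa}_e=\mathbf{R}_{e,z}\hat{\tau}_e+(\mathbf{R}_{e,x,y}\hat{\mathbf{p}}_e+\mathbf{t}_e-\mathbf{r})\times(\mathbf{R}_e\hat{\mathbf{f}}_e)$, is an element of $\mathcal{Q}_\pm$ as a function of $\mathbf{r}$ and all $\hat{\mathbf{f}}_e,\hat{\tau}_e,\hat{\mathbf{p}}_e$.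
   Context: $\mathcal{Q}_{+}$ is the set of functions $\mathbf{s}:\mathbb{R}^n\to\mathbb{R}^m$ (for any $n,m$) such that for each $i=1,\dots,m$ there exist a symmetric positive semidefinite matrix $\mathbf{Q}_i\in\mathbb{R}^{n\times n}$, a vector $\mathbf{q}_i\in\mathbb{R}^n$ and $c_i\in\mathbb{R}$ with $s_i(\mathbf{x})=\mathbf{x}^T\mathbf{Q}_i\mathbf{x}+\mathbf{q}_i^T\mathbf{x}+c_i$ for all $\mathbf{x}$. $\mathcal{Q}_{\pm}$ is the set of functions $\mathbf{s}:\mathbb{R}^n\to\mathbb{R}^m$ such that there exist $\mathbf{s}'\in\mathcal{Q}_{+}$ (with quadratic matrices $\mathbf{Q}_i$) and symmetric positive semidefinite matrices $\mathbf{P}_i\in\mathbb{R}^{n\times n}$ with $s_i(\mathbf{x})=s'_i(\mathbf{x})-\mathbf{x}^T\mathbf{P}_i\mathbf{x}$ for all $\mathbf{x}$ and $i=1,\dots,m$. Interpretation: $\mathbf{r}$ is the center of mass; at a contact, the force $\mathbf{f}=\mathbf{R}\hat{\mathbf{f}}$ and the torque $\mathbf{R}_z\hat\tau$ normal to the contact surface act at the center of pressure $\mathbf{p}=\mathbf{R}_{x,y}\hat{\mathbf{p}}+\mathbf{t}$; $\boldsymbol\kappa$ is the equivalent torque at $\mathbf{r}$. *)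

theory Defs
  imports "HOL-Analysis.Analysis"
begin

unbundle cross3_syntax

definition sym_psd :: "real ^ 'n ^ 'n \<Rightarrow> bool" where
  "sym_psd Q \<longleftrightarrow> transpose Q = Q \<and> (\<forall>x. 0 \<le> x \<bullet> (Q *v x))"

definition Q_plus :: "(real ^ 'n \<Rightarrow> real ^ 'm) set" where
  "Q_plus = {s. \<forall>i. \<exists>Q q c. sym_psd Q \<and> (\<forall>x. s x $ i = x \<bullet> (Q *v x) + q \<bullet> x + c)}"

definition Q_pm :: "(real ^ 'n \<Rightarrow> real ^ 'm) set" where
  "Q_pm = {s. \<exists>s' \<in> Q_plus. \<exists>P. (\<forall>i. sym_psd (P i)) \<and>
                (\<forall>i x. s x $ i = s' x $ i - x \<bullet> (P i *v x))}"

definition cols_xy :: "real ^ 3 ^ 3 \<Rightarrow> real ^ 2 ^ 3" where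
  "cols_xy R = (\<chi> i j. if j = 1 then R $ i $ 1 else R $ i $ 2)"

definition col_z :: "real ^ 3 ^ 3 \<Rightarrow> real ^ 3" where
  "col_z R = column 3 R"

definition com_torque ::
  "real ^ 3 ^ 3 \<Rightarrow> real ^ 3 \<Rightarrow> real ^ 3 \<Rightarrow> real \<Rightarrow> real ^ 2 \<Rightarrow> real ^ 3 \<Rightarrow> real ^ 3" where
  "com_torque R t f \<tau> p r = \<tau> *\<^sub>R col_z R + (cols_xy R *v p + t - r) \<times> (R *v f)"

text \<open>Product domains are Euclidean spaces indexed by sum types.  The coordinates
  \<open>3 + 1 + 2\<close> of a contact are those of the local force, the normal torque and the local
  center of pressure, in this order.\<close>

type_synonym contact_dim = "3 + 1 + 2"

definition force_part :: "real ^ contact_dim \<Rightarrow> real ^ 3" where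
  "force_part u = (\<chi> i. u $ Inl i)"

definition torque_part :: "real ^ contact_dim \<Rightarrow> real" where
  "torque_part u = u $ Inr (Inl 1)"

definition cop_part :: "real ^ contact_dim \<Rightarrow> real ^ 2" where
  "cop_part u = (\<chi> i. u $ Inr (Inr i))"

definition contact_torque ::
  "real ^ 3 ^ 3 \<Rightarrow> real ^ 3 \<Rightarrow> real ^ contact_dim \<Rightarrow> real ^ 3 \<Rightarrow> real ^ 3" where
  "contact_torque R t u r = com_torque R t (force_part u) (torque_part u) (cop_part u) r"

definition single_torque ::
  "real ^ 3 ^ 3 \<Rightarrow> real ^ 3 \<Rightarrow> real ^ (contact_dim + 3) \<Rightarrow> real ^ 3" where
  "single_torque R t x = contact_torque R t (\<chi> i. x $ Inl i) (\<chi> i. x $ Inr i)"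

text \<open>The type \<open>'e\<close> indexes the contacts; all of them share the center of mass in the
  last three coordinates.\<close>

definition momentum_rate ::
  "('e::finite \<Rightarrow> real ^ 3 ^ 3) \<Rightarrow> ('e \<Rightarrow> real ^ 3) \<Rightarrow> ('e \<Rightarrow> real) \<Rightarrow>
    real ^ (('e \<times> contact_dim) + 3) \<Rightarrow> real ^ 3" where
  "momentum_rate R t \<alpha> x =
    (\<Sum>e\<in>UNIV. \<alpha> e *\<^sub>R contact_torque (R e) (t e) (\<chi> i. x $ Inl (e, i)) (\<chi> i. x $ Inr i))"

end

(* Every coordinate of a contact torque is a sum of products of two affine functions, and
   a * b = ((a + b) / 2)^2 - ((a - b) / 2)^2 is a difference of squares of affine functions,
   each of which is a quadratic with a positive semidefinite matrix of rank at most one. *)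

theory Submission
  imports Defs
begin

section \<open>Affine functions\<close>

text \<open>Affinity is given by explicit coefficients because \<open>q\<close> and \<open>c\<close>
  are later read off as the linear and constant terms, and as the data of the rank-one matrix of a
  square.\<close>

definition affine_fun :: "(real ^ 'n \<Rightarrow> real) \<Rightarrow> bool" where
  "affine_fun g \<longleftrightarrow> (\<exists>q c. \<forall>x. g x = q \<bullet> x + c)"

lemma affine_fun_const: "affine_fun (\<lambda>x. c)"
  unfolding affine_fun_def by (rule exI[of _ 0]) auto

lemma affine_fun_component: "affine_fun (\<lambda>x. x $ i)"
  unfolding affine_fun_def
  by (rule exI[of _ "axis i 1"], rule exI[of _ 0]) (simp add: inner_axis')

lemma affine_fun_add:
  assumes "affine_fun f" "affine_fun g"
  shows "affine_fun (\<lambda>x. f x + g x)"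
proof -
  obtain q c q' c' where "\<forall>x. f x = q \<bullet> x + c" "\<forall>x. g x = q' \<bullet> x + c'"
    using assms unfolding affine_fun_def by blast
  then have "\<forall>x. f x + g x = (q + q') \<bullet> x + (c + c')"
    by (simp add: inner_add_left)
  then show ?thesis
    unfolding affine_fun_def by blast
qed

lemma affine_fun_cmult:
  assumes "affine_fun g"
  shows "affine_fun (\<lambda>x. a * g x)"
proof -
  obtain q c where "\<forall>x. g x = q \<bullet> x + c"
    using assms unfolding affine_fun_def by blast
  then have "\<forall>x. a * g x = (a *\<^sub>R q) \<bullet> x + a * c"
    by (simp add: distrib_left)
  then show ?thesis
    unfolding affine_fun_def by blast
qed

lemma affine_fun_diff:
  assumes "affine_fun f" "affine_fun g"
  shows "affine_fun (\<lambda>x. f x - g x)"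
  using affine_fun_add[OF assms(1) affine_fun_cmult[OF assms(2), of "-1"]] by simp

lemma affine_fun_sum:
  assumes "\<And>i. i \<in> I \<Longrightarrow> affine_fun (g i)"
  shows "affine_fun (\<lambda>x. \<Sum>i\<in>I. g i x)"
  using assms
  by (induction I rule: infinite_finite_induct) (auto intro: affine_fun_const affine_fun_add)

lemma affine_fun_matrix_vector_mult:
  assumes "\<And>j. affine_fun (\<lambda>x. v x $ j)"
  shows "affine_fun (\<lambda>x. (A *v v x) $ i)"
  unfolding matrix_vector_mult_def by (simp add: affine_fun_sum affine_fun_cmult assms)

section \<open>Differences of convex quadratic functions\<close>

lemma sym_psd_0: "sym_psd 0"
  by (simp add: sym_psd_def transpose_def vec_eq_iff)

lemma sym_psd_add: "sym_psd P \<Longrightarrow> sym_psd Q \<Longrightarrow> sym_psd (P + Q)"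
  by (simp add: sym_psd_def transpose_def vec_eq_iff matrix_vector_mult_add_rdistrib
      inner_add_right)

lemma sym_psd_scaleR: "0 \<le> a \<Longrightarrow> sym_psd Q \<Longrightarrow> sym_psd (a *\<^sub>R Q)"
  by (simp add: sym_psd_def transpose_def vec_eq_iff flip: scaleR_matrix_vector_assoc)

text \<open>The scalar counterpart of \<open>Q_pm\<close>: the condition that one coordinate
  function has to meet. All closure properties are proved at this level.\<close>

definition quad_diff :: "(real ^ 'n \<Rightarrow> real) \<Rightarrow> bool" where
  "quad_diff g \<longleftrightarrow> (\<exists>Q P q c. sym_psd Q \<and> sym_psd P \<and>
     (\<forall>x. g x = x \<bullet> (Q *v x) + q \<bullet> x + c - x \<bullet> (P *v x)))"

lemma quad_diffI:
  assumes "sym_psd Q" "sym_psd P" "\<And>x. g x = x \<bullet> (Q *v x) + q \<bullet> x + c - x \<bullet> (P *v x)"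
  shows "quad_diff g"
  using assms unfolding quad_diff_def by blast

lemma quad_diffE:
  assumes "quad_diff g"
  obtains Q P q c where "sym_psd Q" "sym_psd P"
    "\<And>x. g x = x \<bullet> (Q *v x) + q \<bullet> x + c - x \<bullet> (P *v x)"
  using assms unfolding quad_diff_def by blast

text \<open>The matrices, vectors and constants of different coordinates are unrelated, so witnesses
  may be chosen coordinate by coordinate and then collected into one vector-valued function.\<close>

lemma Q_pm_iff_quad_diff: "s \<in> Q_pm \<longleftrightarrow> (\<forall>i. quad_diff (\<lambda>x. s x $ i))"
proof
  assume "s \<in> Q_pm"
  then obtain s' P where s': "s' \<in> Q_plus" and P: "\<And>i. sym_psd (P i)"
    and s: "\<And>i x. s x $ i = s' x $ i - x \<bullet> (P i *v x)"
    unfolding Q_pm_def by blast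
  show "\<forall>i. quad_diff (\<lambda>x. s x $ i)"
  proof
    fix i
    obtain Q q c where "sym_psd Q" "\<And>x. s' x $ i = x \<bullet> (Q *v x) + q \<bullet> x + c"
      using s' unfolding Q_plus_def by blast
    with P s show "quad_diff (\<lambda>x. s x $ i)"
      by (intro quad_diffI[of Q "P i"]) auto
  qed
next
  assume "\<forall>i. quad_diff (\<lambda>x. s x $ i)"
  then obtain Q P q c where psd: "\<And>i. sym_psd (Q i)" "\<And>i. sym_psd (P i)"
    and s: "\<And>i x. s x $ i = x \<bullet> (Q i *v x) + q i \<bullet> x + c i - x \<bullet> (P i *v x)"
    unfolding quad_diff_def by metis
  \<comment> \<open>The convex part takes all linear and constant terms; only the forms of the
    \<open>P i\<close> are left to subtract.\<close>
  let ?s' = "\<lambda>x. \<chi> i. x \<bullet> (Q i *v x) + q i \<bullet> x + c i"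
  have "?s' \<in> Q_plus"
    unfolding Q_plus_def using psd(1) by auto
  moreover have "\<And>i x. s x $ i = ?s' x $ i - x \<bullet> (P i *v x)"
    by (simp add: s)
  ultimately show "s \<in> Q_pm"
    unfolding Q_pm_def using psd(2)
    by (intro CollectI bexI[of _ ?s'] exI[of _ P]) auto
qed

lemma quad_diff_affine:
  assumes "affine_fun g"
  shows "quad_diff g"
proof -
  obtain q c where "\<And>x. g x = q \<bullet> x + c"
    using assms unfolding affine_fun_def by blast
  then show ?thesis
    by (intro quad_diffI[OF sym_psd_0 sym_psd_0, of _ q c]) simp
qed

lemma quad_diff_add:
  assumes "quad_diff f" "quad_diff g"
  shows "quad_diff (\<lambda>x. f x + g x)"
proof -
  obtain Q P q c where f: "sym_psd Q" "sym_psd P"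
    "\<And>x. f x = x \<bullet> (Q *v x) + q \<bullet> x + c - x \<bullet> (P *v x)"
    using assms(1) by (elim quad_diffE) blast
  obtain Q' P' q' c' where g: "sym_psd Q'" "sym_psd P'"
    "\<And>x. g x = x \<bullet> (Q' *v x) + q' \<bullet> x + c' - x \<bullet> (P' *v x)"
    using assms(2) by (elim quad_diffE) blast
  show ?thesis
    by (rule quad_diffI[of "Q + Q'" "P + P'" _ "q + q'" "c + c'"])
      (auto simp: f g sym_psd_add matrix_vector_mult_add_rdistrib inner_add_right inner_add_left)
qed

text \<open>Negation exchanges the added and the subtracted quadratic form, so \<open>Q\<close> and
  \<open>P\<close> trade places and only \<open>q\<close> and \<open>c\<close> change sign.\<close>

lemma quad_diff_uminus:
  assumes "quad_diff g"
  shows "quad_diff (\<lambda>x. - g x)"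
proof -
  obtain Q P q c where g: "sym_psd Q" "sym_psd P"
    "\<And>x. g x = x \<bullet> (Q *v x) + q \<bullet> x + c - x \<bullet> (P *v x)"
    using assms by (elim quad_diffE) blast
  show ?thesis
    by (rule quad_diffI[of P Q _ "- q" "- c"]) (auto simp: g)
qed

lemma quad_diff_diff: "quad_diff f \<Longrightarrow> quad_diff g \<Longrightarrow> quad_diff (\<lambda>x. f x - g x)"
  using quad_diff_add[of f "\<lambda>x. - g x"] quad_diff_uminus[of g] by simp

text \<open>Scaling by a nonnegative number preserves semidefiniteness of both matrices. A negative
  \<open>a\<close> is handled by scaling with \<open>- a\<close> and then negating.\<close>

lemma quad_diff_cmult:
  assumes "quad_diff g"
  shows "quad_diff (\<lambda>x. a * g x)"
proof -
  obtain Q P q c where g: "sym_psd Q" "sym_psd P"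
    "\<And>x. g x = x \<bullet> (Q *v x) + q \<bullet> x + c - x \<bullet> (P *v x)"
    using assms by (elim quad_diffE) blast
  have nonneg: "quad_diff (\<lambda>x. b * g x)" if "0 \<le> b" for b
    by (rule quad_diffI[of "b *\<^sub>R Q" "b *\<^sub>R P" _ "b *\<^sub>R q" "b * c"])
      (auto simp: g that sym_psd_scaleR algebra_simps simp flip: scaleR_matrix_vector_assoc)
  show ?thesis
    using nonneg[of a] quad_diff_uminus[OF nonneg[of "- a"]] by (cases "0 \<le> a") auto
qed

lemma quad_diff_sum:
  assumes "\<And>i. i \<in> I \<Longrightarrow> quad_diff (g i)"
  shows "quad_diff (\<lambda>x. \<Sum>i\<in>I. g i x)"
  using assms
  by (induction I rule: infinite_finite_induct)
    (auto intro: quad_diff_affine affine_fun_const quad_diff_add)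

text \<open>Expanding gives (q . x)^2 + 2c (q . x) + c^2, whose quadratic part is the form of the
  outer product of \<open>q\<close> with itself. That form is a square, hence nonnegative, and the
  subtracted matrix can be 0.\<close>

lemma quad_diff_affine_square:
  assumes "affine_fun g"
  shows "quad_diff (\<lambda>x. (g x)\<^sup>2)"
proof -
  obtain q c where g: "\<And>x. g x = q \<bullet> x + c"
    using assms unfolding affine_fun_def by blast
  let ?Q = "\<chi> i j. q $ i * q $ j"
  have Q: "?Q *v x = (q \<bullet> x) *\<^sub>R q" for x
    by (simp add: vec_eq_iff matrix_vector_mult_def inner_vec_def sum_distrib_left
        mult_ac)
  have "sym_psd ?Q"
    unfolding sym_psd_def Q by (simp add: transpose_def vec_eq_iff inner_commute)
  then show ?thesis
    by (rule quad_diffI[OF _ sym_psd_0, of _ _ "(2 * c) *\<^sub>R q" "c\<^sup>2"])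
      (simp add: Q g inner_commute power2_eq_square algebra_simps)
qed

lemma quad_diff_affine_mult:
  assumes "affine_fun f" "affine_fun g"
  shows "quad_diff (\<lambda>x. f x * g x)"
proof -
  have eq: "f x * g x = ((1/2) * (f x + g x))\<^sup>2 - ((1/2) * (f x - g x))\<^sup>2" for x
    by (simp add: power2_eq_square field_simps)
  show ?thesis
    unfolding eq
    by (intro quad_diff_diff quad_diff_affine_square affine_fun_cmult affine_fun_add
        affine_fun_diff assms)
qed

section \<open>Contact torques\<close>

lemma quad_diff_cross3:
  assumes "\<And>i. affine_fun (\<lambda>x. u x $ i)" "\<And>i. affine_fun (\<lambda>x. v x $ i)"
  shows "quad_diff (\<lambda>x. (u x \<times> v x) $ i)"
proof -
  \<comment> \<open>With free indices this one claim covers all three coordinates of the cross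
    product, each being a 2 by 2 minor.\<close>
  have "quad_diff (\<lambda>x. u x $ j * v x $ k - u x $ l * v x $ m)" for j k l m
    by (intro quad_diff_diff quad_diff_affine_mult assms)
  then show ?thesis
    using exhaust_3[of i] by (auto simp: cross3_def)
qed

text \<open>The arguments are arbitrary affine functions of a common variable, so that the same
  bound on the structure serves every domain into which the contact coordinates are
  embedded.\<close>

lemma quad_diff_com_torque:
  assumes "\<And>i. affine_fun (\<lambda>x. f x $ i)" "affine_fun \<tau>"
    "\<And>i. affine_fun (\<lambda>x. p x $ i)" "\<And>i. affine_fun (\<lambda>x. r x $ i)"
  shows "quad_diff (\<lambda>x. com_torque R t (f x) (\<tau> x) (p x) (r x) $ i)"
proof -
  have "affine_fun (\<lambda>x. (cols_xy R *v p x + t - r x) $ i)" for i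
    unfolding vector_add_component vector_minus_component
    by (intro affine_fun_diff affine_fun_add affine_fun_matrix_vector_mult affine_fun_const assms)
  moreover have "affine_fun (\<lambda>x. (R *v f x) $ i)" for i
    by (intro affine_fun_matrix_vector_mult assms)
  ultimately have "quad_diff (\<lambda>x. ((cols_xy R *v p x + t - r x) \<times> (R *v f x)) $ i)"
    by (rule quad_diff_cross3)
  \<comment> \<open>The normal torque enters with a fixed coefficient, so this term is even
    affine.\<close>
  moreover have "quad_diff (\<lambda>x. col_z R $ i * \<tau> x)"
    by (intro quad_diff_affine affine_fun_cmult assms)
  ultimately show ?thesis
    unfolding com_torque_def by (simp add: quad_diff_add mult.commute)
qed

text \<open>The index maps \<open>h\<close> and \<open>k\<close> say where the contact and the
  center of mass sit in the full vector: \<open>Inl\<close> and \<open>Inr\<close> for one contact,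
  \<open>\<lambda>i. Inl (e, i)\<close> and the shared \<open>Inr\<close> for contact
  \<open>e\<close> among several.\<close>

lemma quad_diff_contact_torque:
  "quad_diff (\<lambda>x. contact_torque R t (\<chi> i. x $ h i) (\<chi> i. x $ k i) $ j)"
  unfolding contact_torque_def
  by (rule quad_diff_com_torque)
    (simp_all add: force_part_def torque_part_def cop_part_def affine_fun_component)

theorem mainTheorem2:
  shows "(\<forall>(R :: real ^ 3 ^ 3) (t :: real ^ 3). rotation_matrix R \<longrightarrow> single_torque R t \<in> Q_pm) \<and>
    (\<forall>(R :: 'e::finite \<Rightarrow> real ^ 3 ^ 3) (t :: 'e \<Rightarrow> real ^ 3) (\<alpha> :: 'e \<Rightarrow> real).
        (\<forall>e. rotation_matrix (R e)) \<and> (\<forall>e. \<alpha> e \<in> {0, 1}) \<longrightarrow> momentum_rate R t \<alpha> \<in> Q_pm)"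
proof (intro conjI allI impI)
  fix R :: "real ^ 3 ^ 3" and t :: "real ^ 3"
  show "single_torque R t \<in> Q_pm"
    unfolding Q_pm_iff_quad_diff single_torque_def by (intro allI quad_diff_contact_torque)
next
  fix R :: "'e \<Rightarrow> real ^ 3 ^ 3" and t :: "'e \<Rightarrow> real ^ 3" and \<alpha> :: "'e \<Rightarrow> real"
  show "momentum_rate R t \<alpha> \<in> Q_pm"
    \<comment> \<open>In each coordinate the rate is a linear combination, with coefficients
      \<open>\<alpha> e\<close>, of contact torque coordinates that all live on the same joint
      domain.\<close>
    unfolding Q_pm_iff_quad_diff momentum_rate_def sum_component vector_scaleR_component
      real_scaleR_def
    by (intro allI quad_diff_sum quad_diff_cmult quad_diff_contact_torque)
qed

end
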